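(* For each $n$ let $(d_i)_{i=1}^n=(d_i^{(n)})_{i=1}^n$ be a sequence of nonnegative integers for which at least one simple graph on vertex set $\{1,\dots,n\}$ with $\deg(i)=d_i$ for all $i$ exists, and let $G(n,(d_i)_1^n)$ be a uniformly random simple graph with this degree sequence. Let $\mathcal{C}_1$ be the largest component of $G(n,(d_i)_1^n)$ and $|\mathcal{C}_1|$ its number of vertices. Let $D_n$, $\mu_n$, $\nu_n$ be as defined in the context. Suppose that $\mu_n\to\mu_\infty$ and $\nu_n\to\nu_\infty$ as $n\to\infty$, where $\mu_\infty>0$ and $\nu_\infty<1$ are real constants. Suppose further that for some $\gamma>3$, $$\mathbb{P}(D_n\ge k)=O(k^{1-\gamma})$$ uniformly in $n$ and $k\ge 1$ (i.e. there is a constant $C$ such that $\mathbb{P}(D_n\ge k)\le Ck^{1-\gamma}$ for all $n$ and all integers $k\ge1$). Then there exists a constant $A$ (not depending on $n$) such that $|\mathcal{C}_1|\le A n^{1/(\gamma-1)}$ whp, that is, $\mathbb{P}\bigl(|\mathcal{C}_1|\le A n^{1/(\gamma-1)}\bigr)\to1$ as $n\to\infty$.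
   Context: The degree sequence $(d_i)_1^n$ is deterministic and may depend on $n$ (the dependence is suppressed in the notation). $D_n$ is the degree of a uniformly randomly chosen vertex, so $\mathbb{P}(D_n=k)=n_k/n$ with $n_k:=|\{i\le n: d_i=k\}|$. The parameters are $$\mu_n:=\mathbb{E}D_n=\frac1n\sum_{i=1}^n d_i,\qquad \nu_n:=\frac{1}{n\mu_n}\sum_{i=1}^n d_i(d_i-1).$$ ($\nu_n$ is defined whenever $\mu_n>0$, hence for all large $n$ when $\mu_n\to\mu_\infty>0$.) If there are several largest components, $\mathcal{C}_1$ is any of them. "Whp" (with high probability) means with probability tending to $1$ as $n\to\infty$. *)

theory Defs
  imports "HOL-Probability.Probability" "Graph_Theory.Graph_Theory"
begin

text \<open>
  A simple graph is a \<^locale>\<open>pair_graph\<close>: a finite, loop-free, symmetric set of ordered pairs,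
  where the edge between \<open>i\<close> and \<open>j\<close> is the pair of arcs \<open>(i, j)\<close> and \<open>(j, i)\<close>. An arc is
  determined by its end vertices, so simple graphs on \<open>{1..n}\<close> correspond bijectively to these
  objects, and the degree of a vertex is its out-degree (equivalently, its in-degree).
\<close>

definition graphs_with_degrees :: "nat \<Rightarrow> (nat \<Rightarrow> nat) \<Rightarrow> nat pair_pre_digraph set" where
  "graphs_with_degrees n d =
     {G. pair_graph G \<and> pverts G = {1..n} \<and> (\<forall>i\<in>{1..n}. out_degree (with_proj G) i = d i)}"

text \<open>
  The distribution below is only meaningful when the set is nonempty, which is the
  graphicality assumption on the degree sequence; the set is always finite.
\<close>

definition random_graph :: "nat \<Rightarrow> (nat \<Rightarrow> nat) \<Rightarrow> nat pair_pre_digraph pmf" where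
  "random_graph n d = pmf_of_set (graphs_with_degrees n d)"

text \<open>
  In a symmetric digraph the strongly connected components are the connected components.
  There may be several largest ones.
\<close>

definition largest_component :: "'a pair_pre_digraph \<Rightarrow> 'a set \<Rightarrow> bool" where
  "largest_component G C \<longleftrightarrow>
     is_arg_max card (\<lambda>C. C \<in> pre_digraph.sccs_verts (with_proj G)) C"

definition degree_pmf :: "nat \<Rightarrow> (nat \<Rightarrow> nat) \<Rightarrow> nat pmf" where
  "degree_pmf n d = map_pmf d (pmf_of_set {1..n})"

definition mean_degree :: "nat \<Rightarrow> (nat \<Rightarrow> nat) \<Rightarrow> real" where
  "mean_degree n d = measure_pmf.expectation (degree_pmf n d) real"

definition nu_param :: "nat \<Rightarrow> (nat \<Rightarrow> nat) \<Rightarrow> real" where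
  "nu_param n d =
     (\<Sum>i=1..n. real (d i) * (real (d i) - 1)) / (real n * mean_degree n d)"

lemma mean_degree_eq:
  assumes "n \<ge> 1"
  shows "mean_degree n d = (\<Sum>i=1..n. real (d i)) / real n"
  using assms by (simp add: mean_degree_def degree_pmf_def integral_pmf_of_set)

lemma pmf_degree_pmf:
  assumes "n \<ge> 1"
  shows "pmf (degree_pmf n d) k = real (card {i\<in>{1..n}. d i = k}) / real n"
  using assms
  by (simp add: degree_pmf_def pmf_map measure_pmf_of_set vimage_def Int_def conj_commute)

lemma finite_graphs_with_degrees: "finite (graphs_with_degrees n d)"
proof -
  let ?f = "\<lambda>G::nat pair_pre_digraph. (pverts G, parcs G)"
  have arcs: "parcs G \<subseteq> {1..n} \<times> {1..n}"
    if "pair_graph G" "pverts G = {1..n}" for G :: "nat pair_pre_digraph"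
  proof -
    interpret pair_graph G by fact
    show ?thesis using in_arcsD1 in_arcsD2 that(2) by auto
  qed
  have "?f ` graphs_with_degrees n d \<subseteq> {{1..n}} \<times> Pow ({1..n} \<times> {1..n})"
    using arcs by (auto simp: graphs_with_degrees_def simp del: mem_Sigma_iff intro!: SigmaI)
  then have "finite (?f ` graphs_with_degrees n d)"
    by (rule finite_subset) auto
  moreover have "inj_on ?f (graphs_with_degrees n d)"
    by (rule inj_onI) simp
  ultimately show ?thesis by (rule finite_imageD)
qed

lemma largest_component_exists:
  assumes "G \<in> graphs_with_degrees n d" "n \<ge> 1"
  shows "\<exists>C. largest_component G C"
proof -
  interpret pair_graph G using assms(1) by (simp add: graphs_with_degrees_def)
  have S: "S \<subseteq> pverts G" if "S \<in> sccs_verts" for S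
  proof
    fix u assume "u \<in> S"
    then have "u \<rightarrow>\<^sup>*\<^bsub>with_proj G\<^esub> u"
      using that by (simp add: in_sccs_verts_conv_reachable)
    then show "u \<in> pverts G" by (elim reachable_in_vertsE) simp
  qed
  then have "sccs_verts \<subseteq> Pow (pverts G)" by blast
  then have fin: "finite sccs_verts"
    by (rule finite_subset) (simp add: pair_finite_verts)
  have "1 \<in> pverts G" using assms by (simp add: graphs_with_degrees_def)
  then have "scc_of 1 \<in> sccs_verts" by (rule scc_of_in_sccs_verts)
  then have fin': "finite (card ` sccs_verts)" "card ` sccs_verts \<noteq> {}" using fin by auto
  from Max_in[OF this] obtain C where C: "C \<in> sccs_verts" "Max (card ` sccs_verts) = card C"
    by (rule imageE) simp
  have "card C' \<le> card C" if "C' \<in> sccs_verts" for C'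
    using Max_ge[OF fin'(1) imageI[OF that]] C(2) by simp
  with C(1) have "is_arg_max card (\<lambda>C. C \<in> sccs_verts) C"
    by (simp add: is_arg_max_linorder)
  then show ?thesis unfolding largest_component_def by (rule exI)
qed

end

theory Submission
  imports Defs
begin

text \<open>
  The uniform simple graph is explored directly, without the configuration model. Conditioned on
  the edges found so far, a switching argument bounds the probability that the next half-edge
  leads to \<open>w\<close> by about \<open>d w / (n \<mu>)\<close>: all corrections are of order \<open>\<Delta>\<^sup>2\<close>, where the maximum
  degree \<open>\<Delta>\<close> is \<open>O(n powr (1 / (\<gamma> - 1)))\<close>, so that \<open>\<Delta>\<^sup>2 = o(n)\<close>. Hence the number of free
  half-edges of the explored part has drift at most \<open>\<nu> - 1 + o(1) < 0\<close> per step. Its jumps are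
  bounded by \<open>\<Delta>\<close>, and its exponential moment at \<open>s = b * ln n / n powr (1 / (\<gamma> - 1))\<close>, for
  small \<open>b\<close>, is governed by the drift, because the degrees have uniformly bounded moments of
  some order \<open>2 + \<epsilon>\<close>. The exploration therefore survives for \<open>A * n powr (1 / (\<gamma> - 1))\<close> steps
  with probability at most a power of \<open>n\<close> whose exponent is as negative as desired if \<open>A\<close> is
  large, and a union bound over the starting vertex suffices.
\<close>

section \<open>Simple graphs as symmetric relations, and switchings\<close>

text \<open>On a fixed vertex set a simple graph is just its set of arcs. Both arcs of every edge
  are kept, so cardinalities count edges twice. \<open>F\<close> is the part already revealed;
  \<open>F = {}\<close> gives all graphs with these degrees.\<close>

definition realizations :: "'a set \<Rightarrow> ('a \<Rightarrow> nat) \<Rightarrow> 'a rel \<Rightarrow> 'a rel set" where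
  "realizations V d F =
     {E. E \<subseteq> V \<times> V \<and> sym E \<and> irrefl E \<and> (\<forall>i\<in>V. card (E `` {i}) = d i) \<and> F \<subseteq> E}"

lemma finite_realizations: "finite V \<Longrightarrow> finite (realizations V d F)"
  by (rule finite_subset[of _ "Pow (V \<times> V)"]) (auto simp: realizations_def)

lemma realizationsD:
  assumes "E \<in> realizations V d F"
  shows "E \<subseteq> V \<times> V" "sym E" "irrefl E" "\<And>i. i \<in> V \<Longrightarrow> card (E `` {i}) = d i" "F \<subseteq> E"
  using assms by (auto simp: realizations_def)

lemma card_arcs_from:
  assumes "finite X" "finite E"
  shows "card {(x, y) \<in> E. x \<in> X} = (\<Sum>x\<in>X. card (E `` {x}))"
proof -
  have "{(x, y) \<in> E. x \<in> X} = Sigma X (\<lambda>x. E `` {x})"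
    by auto
  moreover have "finite (E `` {x})" for x
    using assms by (simp add: finite_Image)
  ultimately show ?thesis
    using assms by (simp add: card_SigmaI)
qed

lemma card_realization:
  assumes "E \<in> realizations V d F" "finite V"
  shows "card E = (\<Sum>i\<in>V. d i)"
proof -
  note E = realizationsD[OF assms(1)]
  have "finite E" using E(1) assms(2) finite_subset by blast
  have "E = {(x, y) \<in> E. x \<in> V}" using E(1) by auto
  then have "card E = (\<Sum>x\<in>V. card (E `` {x}))"
    using card_arcs_from[OF assms(2) \<open>finite E\<close>] by simp
  then show ?thesis using E(4) by simp
qed

text \<open>The edges \<open>uw\<close> and \<open>xy\<close> are replaced by \<open>ux\<close> and
  \<open>wy\<close>. Exchanging the roles of \<open>w\<close> and \<open>x\<close> undoes
  this.\<close>

definition switch :: "'a rel \<Rightarrow> 'a \<Rightarrow> 'a \<Rightarrow> 'a \<Rightarrow> 'a \<Rightarrow> 'a rel" where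
  "switch E u w x y =
     (E - {(u, w), (w, u), (x, y), (y, x)}) \<union> {(u, x), (x, u), (w, y), (y, w)}"

text \<open>Each of the four vertices loses one neighbour and gains another, so the degrees survive.
  The two non-edges make the gained neighbours new and also rule out \<open>x = w\<close> and
  \<open>y = u\<close>. \<open>F\<close> is kept because neither removed edge belongs to it.\<close>

lemma switch_realizations:
  assumes E: "E \<in> realizations V d (F \<union> {(u, w), (w, u)})"
    and "finite V" "sym F" "(u, w) \<notin> F"
    and xy: "(x, y) \<in> E - F" "x \<noteq> u" "y \<noteq> w" "(u, x) \<notin> E" "(w, y) \<notin> E"
  shows "switch E u w x y \<in> realizations V d F"
    and "switch (switch E u w x y) u x w y = E"
proof -
  note E' = realizationsD[OF E]
  have ne: "u \<noteq> w" "x \<noteq> y"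
    using E'(3,5) xy(1) by (auto simp: irrefl_def)
  have "x \<noteq> w" "y \<noteq> u" using xy E'(5) by auto
  note ne = this ne xy(2,3)
  have inE: "(u, w) \<in> E" "(w, u) \<in> E" "(x, y) \<in> E" "(y, x) \<in> E"
    using E'(2,5) xy(1) by (auto dest: symD)
  have notE: "(x, u) \<notin> E" "(y, w) \<notin> E" using E'(2) xy(4,5) by (auto dest: symD)
  have V: "u \<in> V" "w \<in> V" "x \<in> V" "y \<in> V" using inE E'(1) by auto
  have fin: "finite (E `` {i})" for i
    using E'(1) \<open>finite V\<close> by (meson finite_Image finite_SigmaI finite_subset)
  have exch: "card (insert b (E `` {i} - {a})) = card (E `` {i})"
    if "(i, a) \<in> E" "(i, b) \<notin> E" for i a b
  proof -
    have "card (insert b (E `` {i} - {a})) = Suc (card (E `` {i} - {a}))"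
      using that fin[of i] by (subst card_insert_disjoint) auto
    also have "\<dots> = card (E `` {i})"
      using that fin[of i] by (intro card_Suc_Diff1) auto
    finally show ?thesis .
  qed
  have deg: "card (switch E u w x y `` {i}) = card (E `` {i})" for i
  proof -
    consider "i = u" | "i = w" | "i = x" | "i = y" | "i \<notin> {u, w, x, y}" by auto
    then show ?thesis
    proof cases
      case 1
      then have "switch E u w x y `` {i} = insert x (E `` {i} - {w})"
        using ne by (auto simp: switch_def)
      then show ?thesis using exch[of i w x] 1 inE xy by simp
    next
      case 2
      then have "switch E u w x y `` {i} = insert y (E `` {i} - {u})"
        using ne by (auto simp: switch_def)
      then show ?thesis using exch[of i u y] 2 inE xy by simp
    next
      case 3
      then have "switch E u w x y `` {i} = insert u (E `` {i} - {y})"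
        using ne by (auto simp: switch_def)
      then show ?thesis using exch[of i y u] 3 inE notE by simp
    next
      case 4
      then have "switch E u w x y `` {i} = insert w (E `` {i} - {x})"
        using ne by (auto simp: switch_def)
      then show ?thesis using exch[of i x w] 4 inE notE by simp
    next
      case 5
      then have "switch E u w x y `` {i} = E `` {i}"
        by (auto simp: switch_def)
      then show ?thesis by simp
    qed
  qed
  have "sym (switch E u w x y)"
    using E'(2) by (auto simp: switch_def sym_def)
  moreover have "irrefl (switch E u w x y)"
    using E'(3) ne by (auto simp: switch_def irrefl_def)
  moreover have "F \<subseteq> switch E u w x y"
    using E'(5) xy assms(3,4) by (auto simp: switch_def dest: symD)
  moreover have "switch E u w x y \<subseteq> V \<times> V"
    using E'(1) V by (auto simp: switch_def)
  ultimately show "switch E u w x y \<in> realizations V d F"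
    using deg E'(4) by (simp add: realizations_def)
  show "switch (switch E u w x y) u x w y = E"
    using ne inE notE xy unfolding switch_def by blast
qed

text \<open>
  In the uniform model conditioned on containing \<open>F\<close> this bounds the probability of the edge
  \<open>uw\<close> by essentially the value that it has in the configuration model.
\<close>

lemma card_realizations_insert_edge:
  assumes "finite V" "sym F" "(u, w) \<notin> F" "u \<in> V" "w \<in> V"
    and \<Delta>: "\<And>i. i \<in> V \<Longrightarrow> d i \<le> \<Delta>"
  shows "card (realizations V d (F \<union> {(u, w), (w, u)})) *
           ((\<Sum>i\<in>V. d i) - card F - 2 * (\<Delta> * (\<Delta> + 1)))
         \<le> card (realizations V d F) * ((d u - card (F `` {u})) * (d w - card (F `` {w})))"
proof -
  define R' where "R' = realizations V d (F \<union> {(u, w), (w, u)})"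
  define K where "K = (\<Sum>i\<in>V. d i) - card F - 2 * (\<Delta> * (\<Delta> + 1))"
  \<comment> \<open>The switching is counted from both sides: \<open>good E\<close> holds the arcs
    that can be switched against \<open>uw\<close>, and \<open>T\<close> the pairs that a reverse
    switching may use, namely neighbours of \<open>u\<close> and of \<open>w\<close> outside
    \<open>F\<close>.\<close>
  define good where
    "good E = {(x, y) \<in> E - F. x \<noteq> u \<and> y \<noteq> w \<and> (u, x) \<notin> E \<and> (w, y) \<notin> E}" for E
  define T where "T E = (E `` {u} - F `` {u}) \<times> (E `` {w} - F `` {w})" for E
  define \<phi> where "\<phi> = (\<lambda>(E, x, y). (switch E u w x y, x, y))"
  have finR: "finite R'" "finite (realizations V d F)"
    using assms(1) by (auto simp: R'_def finite_realizations)
  have finE: "finite E" if "E \<in> realizations V d F'" for E F'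
    using realizationsD(1)[OF that] assms(1) by (meson finite_SigmaI finite_subset)
  have card_T: "card (T E) = (d u - card (F `` {u})) * (d w - card (F `` {w}))"
    and fin_T: "finite (T E)" if "E \<in> realizations V d F" for E
  proof -
    note E = realizationsD[OF that]
    have "card (E `` {i} - F `` {i}) = d i - card (F `` {i})" if "i \<in> V" for i
      using that E(4,5) finE[OF \<open>E \<in> realizations V d F\<close>]
      by (subst card_Diff_subset) (auto intro: finite_Image finite_subset)
    then show "card (T E) = (d u - card (F `` {u})) * (d w - card (F `` {w}))"
      using assms by (simp add: T_def card_cartesian_product)
    show "finite (T E)" using finE[OF that] by (simp add: T_def finite_Image)
  qed
  have card_good: "K \<le> card (good E)" and fin_good: "finite (good E)" if "E \<in> R'" for E
  proof -
    note E = realizationsD[OF that[unfolded R'_def]]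
    have fE: "finite E" using finE that by (auto simp: R'_def)
    then show fin: "finite (good E)"
      by (rule rev_finite_subset) (auto simp: good_def)
    define U where "U z = {(x, y) \<in> E. x \<in> insert z (E `` {z})}" for z
    have U: "card (U z) \<le> \<Delta> * (\<Delta> + 1)" if "z \<in> V" for z
    proof -
      have "card (U z) = (\<Sum>x\<in>insert z (E `` {z}). card (E `` {x}))"
        using fE by (simp add: U_def card_arcs_from finite_Image del: sum.insert_if sum.insert insert_iff)
      also have "\<dots> \<le> (\<Sum>x\<in>insert z (E `` {z}). \<Delta>)"
        using \<Delta> E(1,4) that by (intro sum_mono) auto
      also have "\<dots> = card (insert z (E `` {z})) * \<Delta>" by simp
      also have "\<dots> \<le> Suc \<Delta> * \<Delta>"
        using \<Delta>[OF that] E(4)[OF that] card_insert_le_m1[of "Suc \<Delta>" "E `` {z}" z]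
        by (intro mult_right_mono) auto
      finally show ?thesis by (simp add: algebra_simps)
    qed
    have fU: "finite (U z)" for z
      by (rule rev_finite_subset[OF fE]) (auto simp: U_def)
    have finF: "finite F" using E(5) fE by (meson finite_subset le_sup_iff)
    \<comment> \<open>An arc \<open>(x, y)\<close> fails to be good only if it lies in
      \<open>F\<close>, starts in the closed neighbourhood of \<open>u\<close>, or ends in that of
      \<open>w\<close>. \<open>U w\<close> collects arcs by their start, hence the swap.\<close>
    have "E \<subseteq> good E \<union> F \<union> U u \<union> prod.swap ` U w"
    proof
      fix p assume p: "p \<in> E"
      obtain x y where "p = (x, y)" by force
      moreover have "(y, x) \<in> E" using p calculation E(2) by (auto dest: symD)
      moreover have "(x, y) \<in> prod.swap ` U w" if "y \<in> insert w (E `` {w})"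
        using that calculation by (auto simp: U_def intro!: image_eqI[of _ _ "(y, x)"])
      ultimately show "p \<in> good E \<union> F \<union> U u \<union> prod.swap ` U w"
        using p by (auto simp: good_def U_def)
    qed
    then have "card E \<le> card (good E \<union> F \<union> U u \<union> prod.swap ` U w)"
      by (intro card_mono) (use fin finF fU in auto)
    also have "\<dots> \<le> card (good E) + card F + card (U u) + card (prod.swap ` U w)"
      by (meson add_mono card_Un_le order.trans order_refl)
    also have "card (prod.swap ` U w) \<le> card (U w)" by (rule card_image_le[OF fU])
    finally have "card E \<le> card (good E) + card F + card (U u) + card (U w)" by simp
    then show "K \<le> card (good E)"
      using U[OF assms(4)] U[OF assms(5)] card_realization[OF that[unfolded R'_def] assms(1)]
      by (simp add: K_def)
  qed
  have sw: "switch E u w x y \<in> realizations V d F" "switch (switch E u w x y) u x w y = E"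
    if "E \<in> R'" "(x, y) \<in> good E" for E x y
    using switch_realizations[of E V d F u w x y] assms that by (auto simp: R'_def good_def)
  \<comment> \<open>\<open>\<phi>\<close> remembers \<open>x\<close> and \<open>y\<close>, so the
    reverse switching recovers \<open>E\<close>.\<close>
  have inj: "inj_on \<phi> (Sigma R' good)"
  proof (rule inj_onI)
    fix p q assume p: "p \<in> Sigma R' good" and q: "q \<in> Sigma R' good" and eq: "\<phi> p = \<phi> q"
    obtain E x y where pE: "p = (E, x, y)" by (cases p) auto
    obtain E' x' y' where qE: "q = (E', x', y')" by (cases q) auto
    have same: "x' = x" "y' = y" "switch E u w x y = switch E' u w x y"
      using eq by (auto simp: \<phi>_def pE qE)
    have "E = switch (switch E u w x y) u x w y"
      using p sw(2)[of E x y] by (simp add: pE)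
    also have "\<dots> = switch (switch E' u w x y) u x w y"
      by (simp only: same)
    also have "\<dots> = E'"
      using q sw(2)[of E' x y] by (simp add: qE same(1,2))
    finally show "p = q" by (simp add: pE qE same(1,2))
  qed
  have img: "\<phi> ` Sigma R' good \<subseteq> Sigma (realizations V d F) T"
  proof -
    have "(x, y) \<in> T (switch E u w x y)" if "E \<in> R'" "(x, y) \<in> good E" for E x y
    proof -
      have "F \<subseteq> E" using realizationsD(5)[OF that(1)[unfolded R'_def]] by simp
      then show ?thesis using that by (auto simp: T_def good_def switch_def)
    qed
    then show ?thesis using sw(1) by (auto simp: \<phi>_def)
  qed
  have "card R' * K = (\<Sum>E\<in>R'. K)" by simp
  also have "\<dots> \<le> (\<Sum>E\<in>R'. card (good E))" by (intro sum_mono card_good)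
  also have "\<dots> = card (Sigma R' good)"
    using finR fin_good by (simp add: card_SigmaI)
  also have "\<dots> \<le> card (Sigma (realizations V d F) T)"
    using finR fin_T by (intro card_inj_on_le[OF inj img] finite_SigmaI) auto
  also have "\<dots> = (\<Sum>E\<in>realizations V d F. card (T E))"
    using finR fin_T by (simp add: card_SigmaI)
  also have "\<dots> = card (realizations V d F) * ((d u - card (F `` {u})) * (d w - card (F `` {w})))"
    using card_T by simp
  finally show ?thesis by (simp add: R'_def K_def)
qed

section \<open>Revealing a component edge by edge\<close>

text \<open>Double counting of the pairs \<open>(E, w)\<close>: every realization has the same
  number of edges at \<open>u\<close> outside \<open>F\<close>. This is the law of total probability
  over the other end of the next edge at \<open>u\<close>, in counting form.\<close>

lemma sum_card_realizations_insert_edge: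
  assumes "finite V" "sym F" "u \<in> V"
  shows "(\<Sum>w\<in>{w\<in>V. (u, w) \<notin> F}. card {E \<in> realizations V d (F \<union> {(u, w), (w, u)}). P E})
         = (d u - card (F `` {u})) * card {E \<in> realizations V d F. P E}"
proof -
  let ?S = "{E \<in> realizations V d F. P E}" and ?W = "{w\<in>V. (u, w) \<notin> F}"
  have "{E \<in> realizations V d (F \<union> {(u, w), (w, u)}). P E} = {E \<in> ?S. (u, w) \<in> E}" for w
    by (auto simp: realizations_def dest: symD)
  then have "(\<Sum>w\<in>?W. card {E \<in> realizations V d (F \<union> {(u, w), (w, u)}). P E})
      = (\<Sum>w\<in>?W. card {E \<in> ?S. (u, w) \<in> E})"
    by (simp only:)
  also have "\<dots> = (\<Sum>E\<in>?S. d u - card (F `` {u}))"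
  proof (rule sum_multicount_gen)
    show "finite ?W" "finite ?S" using assms(1) by (auto simp: finite_realizations)
    show "\<forall>E\<in>?S. card {w\<in>?W. (u, w) \<in> E} = d u - card (F `` {u})"
    proof
      fix E assume "E \<in> ?S"
      then have E: "E \<subseteq> V \<times> V" "card (E `` {u}) = d u" "F \<subseteq> E"
        using assms(3) by (auto simp: realizations_def)
      have "finite (F `` {u})"
        using E(1,3) assms(1) by (intro finite_subset[of "F `` {u}" V]) auto
      moreover have "{w\<in>?W. (u, w) \<in> E} = E `` {u} - F `` {u}" using E(1) by auto
      ultimately show "card {w\<in>?W. (u, w) \<in> E} = d u - card (F `` {u})"
        using E by (simp add: card_Diff_subset Image_mono)
    qed
  qed
  finally show ?thesis by (simp add: mult.commute)
qed

text \<open>The new edge uses up one half-edge at \<open>u\<close> and one at \<open>w\<close>,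
  hence the \<open>- 2\<close>. A vertex \<open>w\<close> outside \<open>D\<close> brings at most
  \<open>d w\<close> new half-edges, a vertex in \<open>D\<close> brings none.\<close>

lemma residual_insert_edge_le:
  fixes d :: "'a \<Rightarrow> nat"
  assumes "finite D" "finite F" "u \<in> D" "u \<noteq> w" "(u, w) \<notin> F" "sym F" "F \<subseteq> D \<times> D"
  shows "(\<Sum>i\<in>insert w D. real (d i) - real (card ((F \<union> {(u, w), (w, u)}) `` {i})))
         \<le> (\<Sum>i\<in>D. real (d i) - real (card (F `` {i}))) + real (d w) - 2"
proof -
  let ?F' = "F \<union> {(u, w), (w, u)}"
  have "(w, u) \<notin> F" using assms by (auto dest: symD)
  have fin: "finite (F `` {i})" for i using assms by (simp add: finite_Image)
  have *: "real (card (?F' `` {i})) = real (card (F `` {i})) + of_bool (i = u) + of_bool (i = w)" for i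
  proof -
    consider "i = u" | "i = w" | "i \<notin> {u, w}" by auto
    then show ?thesis
    proof cases
      case 1
      then have "?F' `` {i} = insert w (F `` {i})" using assms by auto
      then show ?thesis using 1 assms fin by simp
    next
      case 2
      then have "?F' `` {i} = insert u (F `` {i})" using assms by auto
      then show ?thesis using 2 assms fin \<open>(w, u) \<notin> F\<close> by simp
    next
      case 3
      then have "?F' `` {i} = F `` {i}" by auto
      then show ?thesis using 3 by simp
    qed
  qed
  have "(\<Sum>i\<in>insert w D. real (d i) - real (card (?F' `` {i})))
      = (\<Sum>i\<in>insert w D. real (d i) - real (card (F `` {i})))
        - (\<Sum>i\<in>insert w D. of_bool (i = u)) - (\<Sum>i\<in>insert w D. of_bool (i = w))"
    unfolding * by (simp add: sum_subtractf sum.distrib)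
  also have "(\<Sum>i\<in>insert w D. of_bool (i = u)) = (1::real)"
    using assms by (simp add: of_bool_def sum.delta)
  also have "(\<Sum>i\<in>insert w D. of_bool (i = w)) = (1::real)"
    using assms by (simp add: of_bool_def sum.delta)
  also have "(\<Sum>i\<in>insert w D. real (d i) - real (card (F `` {i})))
      \<le> (\<Sum>i\<in>D. real (d i) - real (card (F `` {i}))) + real (d w)"
    using assms by (cases "w \<in> D") (simp_all add: insert_absorb)
  finally show ?thesis by simp
qed

text \<open>
  The component of \<open>v\<close> is explored one edge at a time: \<open>F\<close> consists of the \<open>t\<close> edges found so
  far, \<open>D\<close> of the vertices seen. The exponential of the residual degree of \<open>D\<close>, divided by
  \<open>\<rho> ^ t\<close>, is a supermartingale, and more than \<open>m\<close> vertices can only be reached if the residual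
  degree stays positive for \<open>m\<close> steps.
\<close>

lemma card_large_component_aux:
  fixes d :: "'a \<Rightarrow> nat" and s \<rho> Q :: real
  assumes V: "finite V" and \<Delta>: "\<And>i. i \<in> V \<Longrightarrow> d i \<le> \<Delta>"
    and Q: "0 < Q" "Q \<le> real (\<Sum>i\<in>V. d i) - 2 * real m - 2 * (real \<Delta> * (real \<Delta> + 1))"
    and s: "0 \<le> s" and \<rho>: "0 < \<rho>"
      "1 + (\<Sum>w\<in>V. real (d w) / Q * (exp (s * real (d w)) - 1)) \<le> \<rho> * exp (2 * s)"
    and "t \<le> m" "v \<in> D" "D \<subseteq> V" "card D \<le> t + 1" "sym F" "F \<subseteq> D \<times> D" "card F = 2 * t"
  shows "real (card {E \<in> realizations V d F. m < card (E\<^sup>* `` {v})})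
    \<le> real (card (realizations V d F))
        * exp (s * (\<Sum>i\<in>D. real (d i) - real (card (F `` {i})))) * \<rho> ^ (m - t)"
  using assms(8-)
proof (induction "m - t" arbitrary: t D F)
  case 0
  have "finite D" using \<open>D \<subseteq> V\<close> V finite_subset by blast
  \<comment> \<open>With no steps left the trivial bound suffices: if a realization exists, the
    residual degrees are nonnegative and the exponential factor is at least 1.\<close>
  show ?case
  proof (cases "realizations V d F = {}")
    case False
    then obtain E where E: "E \<in> realizations V d F" by auto
    have "card (F `` {i}) \<le> d i" if "i \<in> D" for i
    proof -
      have "card (F `` {i}) \<le> card (E `` {i})"
        using realizationsD(1,5)[OF E] V
        by (intro card_mono Image_mono finite_subset[of "E `` {i}" V]) auto
      then show ?thesis using realizationsD(4)[OF E] that 0 by auto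
    qed
    then have "0 \<le> (\<Sum>i\<in>D. real (d i) - real (card (F `` {i})))"
      by (intro sum_nonneg) auto
    then have exp: "1 \<le> exp (s * (\<Sum>i\<in>D. real (d i) - real (card (F `` {i}))))"
      using s by simp
    have "real (card {E \<in> realizations V d F. m < card (E\<^sup>* `` {v})})
        \<le> real (card (realizations V d F)) * 1"
      using V by (simp add: card_mono finite_realizations)
    also have "\<dots> \<le> real (card (realizations V d F))
        * exp (s * (\<Sum>i\<in>D. real (d i) - real (card (F `` {i}))))"
      by (intro mult_left_mono exp) simp
    finally have "real (card {E \<in> realizations V d F. m < card (E\<^sup>* `` {v})})
        \<le> real (card (realizations V d F)) * exp (s * (\<Sum>i\<in>D. real (d i) - real (card (F `` {i}))))" .
    then show ?thesis using 0 by simp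
  qed simp
next
  case (Suc l t D F)
  let ?N = "\<lambda>F. real (card (realizations V d F))"
  let ?B = "\<lambda>F. real (card {E \<in> realizations V d F. m < card (E\<^sup>* `` {v})})"
  let ?S = "\<Sum>i\<in>D. real (d i) - real (card (F `` {i}))"
  have fD: "finite D" using Suc.prems V finite_subset by blast
  have fF: "finite F" using Suc.prems fD finite_subset by blast
  have l: "m - t = Suc l" "m - Suc t = l" "t < m" using Suc.hyps Suc.prems by auto
  have le_d: "card (F `` {i}) \<le> d i" if "i \<in> D" "E \<in> realizations V d F" for i E
  proof -
    have "card (F `` {i}) \<le> card (E `` {i})"
      using realizationsD(1,5)[OF that(2)] V
      by (intro card_mono Image_mono finite_subset[of "E `` {i}" V]) auto
    then show ?thesis using realizationsD(4)[OF that(2)] that Suc.prems by auto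
  qed
  show ?case
  proof (cases "\<exists>u\<in>D. card (F `` {u}) < d u")
    \<comment> \<open>Without free half-edges \<open>D\<close> is closed under adjacency in every
      realization. The component then has at most \<open>t + 1 \<le> m\<close> vertices, and the
      event is empty.\<close>
    case False
    have "card (E\<^sup>* `` {v}) \<le> m" if "E \<in> realizations V d F" for E
    proof -
      note E = realizationsD[OF that]
      have "E `` {i} = F `` {i}" if "i \<in> D" for i
      proof -
        have "finite (E `` {i})" using E(1) V by (intro finite_subset[of "E `` {i}" V]) auto
        moreover have "card (F `` {i}) = card (E `` {i})"
          using False le_d[OF that \<open>E \<in> _\<close>] E(4) that Suc.prems by force
        ultimately show ?thesis using E(5) by (metis Image_mono card_subset_eq order_refl)
      qed
      then have "E `` D \<subseteq> D" using Suc.prems(6) by blast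
      then have "E\<^sup>* `` D = D" by (rule Image_closed_trancl)
      then have "E\<^sup>* `` {v} \<subseteq> D" using Suc.prems(2) by blast
      then have "card (E\<^sup>* `` {v}) \<le> card D" using fD card_mono by blast
      then show ?thesis using Suc.prems l by simp
    qed
    then have "{E \<in> realizations V d F. m < card (E\<^sup>* `` {v})} = {}" by force
    then show ?thesis using \<rho>(1) by (simp only: card.empty of_nat_0) simp
  next
    case True
    then obtain u where u: "u \<in> D" "card (F `` {u}) < d u" by auto
    then have uV: "u \<in> V" using Suc.prems by auto
    define k where "k = real (d u - card (F `` {u}))"
    have k: "k > 0" using u by (simp add: k_def)
    define W where "W = {w\<in>V. (u, w) \<notin> F}"
    have fW: "finite W" "W \<subseteq> V" using V by (auto simp: W_def)
    define F' where "F' w = F \<union> {(u, w), (w, u)}" for w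
    \<comment> \<open>The part of the induction bound for \<open>F' w\<close> that does not depend
      on \<open>w\<close>. Its \<open>- 2\<close> is paid for later by the factor
      \<open>exp (2 * s)\<close> in the hypothesis on \<open>\<rho>\<close>.\<close>
    define c where "c = exp (s * (?S - 2)) * \<rho> ^ l"
    have c: "c > 0" using \<rho>(1) by (simp add: c_def)
    have B_le: "?B (F' w) \<le> ?N (F' w) * exp (s * real (d w)) * c" if w: "w \<in> W" for w
    proof (cases "u = w")
      \<comment> \<open>\<open>W\<close> may contain \<open>u\<close> itself, but a loop has no
        realization.\<close>
      case True
      then have "realizations V d (F' w) = {}"
        by (auto simp: realizations_def irrefl_def F'_def)
      then show ?thesis by simp
    next
      case False
      have wF: "(u, w) \<notin> F" "(w, u) \<notin> F" using w Suc.prems(5) by (auto simp: W_def dest: symD)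
      have "?B (F' w) \<le> ?N (F' w)
          * exp (s * (\<Sum>i\<in>insert w D. real (d i) - real (card (F' w `` {i})))) * \<rho> ^ (m - Suc t)"
      proof (rule Suc.hyps(1))
        show "card (F' w) = 2 * Suc t"
          using False fF wF Suc.prems by (simp add: F'_def)
        show "sym (F' w)" using Suc.prems(5) by (auto simp: F'_def sym_def)
        show "card (insert w D) \<le> Suc t + 1"
          using Suc.prems(4) fD by (simp add: card_insert_if)
      qed (use l Suc.prems u w fW in \<open>auto simp: F'_def\<close>)
      also have "\<dots> \<le> ?N (F' w) * exp (s * (?S + real (d w) - 2)) * \<rho> ^ (m - Suc t)"
        using residual_insert_edge_le[OF fD fF u(1) False wF(1) Suc.prems(5,6), of d] s \<rho>(1)
        by (intro mult_right_mono mult_left_mono) (auto simp: F'_def mult_left_mono)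
      also have "\<dots> = ?N (F' w) * exp (s * real (d w)) * c"
        by (simp add: c_def l flip: exp_add) (simp add: algebra_simps)
      finally show ?thesis .
    qed
    have N_le: "?N (F' w) \<le> ?N F * k * (real (d w) / Q)" if w: "w \<in> W" for w
    proof -
      have wV: "w \<in> V" "(u, w) \<notin> F" using w by (auto simp: W_def)
      let ?K = "(\<Sum>i\<in>V. d i) - card F - 2 * (\<Delta> * (\<Delta> + 1))"
      \<comment> \<open>At most \<open>m\<close> edges have been revealed, so
        \<open>card F \<le> 2 * m\<close>; this is the term \<open>2 * real m\<close> in the bound
        on \<open>Q\<close>.\<close>
      have "Q \<le> real ?K"
      proof -
        have "real (\<Sum>i\<in>V. d i) - real (card F) - real (2 * (\<Delta> * (\<Delta> + 1))) \<le> real ?K"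
          by linarith
        then show ?thesis using Q(2) Suc.prems by (simp add: algebra_simps)
      qed
      then have "?N (F' w) * Q \<le> real (card (realizations V d (F' w)) * ?K)"
        unfolding of_nat_mult by (intro mult_left_mono) auto
      also have "\<dots> \<le> real (card (realizations V d F)
          * ((d u - card (F `` {u})) * (d w - card (F `` {w}))))"
        unfolding F'_def
        by (intro of_nat_mono card_realizations_insert_edge V \<Delta> Suc.prems wV uV)
      also have "\<dots> = ?N F * k * real (d w - card (F `` {w}))"
        by (simp add: k_def)
      also have "\<dots> \<le> ?N F * k * real (d w)"
        using k by (intro mult_left_mono) auto
      finally show ?thesis using Q(1) by (simp add: field_simps)
    qed
    have "k * ?B F = (\<Sum>w\<in>W. ?B (F' w))"
      using sum_card_realizations_insert_edge[OF V Suc.prems(5) uV, of d "\<lambda>E. m < card (E\<^sup>* `` {v})"]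
      unfolding k_def W_def F'_def by (simp only: of_nat_mult flip: of_nat_sum)
    also have "\<dots> \<le> (\<Sum>w\<in>W. ?N (F' w) * exp (s * real (d w)) * c)"
      by (intro sum_mono B_le)
    \<comment> \<open>Splitting off the 1 from the exponential matters: the first sum is then known
      exactly, and the error of the switching bound only enters the excess, which is small with
      \<open>s\<close>.\<close>
    also have "\<dots> = c * ((\<Sum>w\<in>W. ?N (F' w)) + (\<Sum>w\<in>W. ?N (F' w) * (exp (s * real (d w)) - 1)))"
      by (simp add: sum_distrib_left algebra_simps flip: sum.distrib)
    also have "\<dots> \<le> c * (k * ?N F + (\<Sum>w\<in>V. ?N F * k * (real (d w) / Q) * (exp (s * real (d w)) - 1)))"
    proof -
      have "(\<Sum>w\<in>W. ?N (F' w)) = k * ?N F"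
        using sum_card_realizations_insert_edge[OF V Suc.prems(5) uV, of d "\<lambda>E. True"]
        unfolding k_def W_def F'_def by (simp only: of_nat_mult simp_thms Collect_mem_eq flip: of_nat_sum)
      moreover have "(\<Sum>w\<in>W. ?N (F' w) * (exp (s * real (d w)) - 1))
          \<le> (\<Sum>w\<in>W. ?N F * k * (real (d w) / Q) * (exp (s * real (d w)) - 1))"
        using s by (intro sum_mono mult_right_mono N_le) auto
      moreover have "\<dots> \<le> (\<Sum>w\<in>V. ?N F * k * (real (d w) / Q) * (exp (s * real (d w)) - 1))"
        using s k Q(1) fW V by (intro sum_mono2) auto
      ultimately show ?thesis using c by (intro mult_left_mono) auto
    qed
    also have "\<dots> = c * (k * ?N F) * (1 + (\<Sum>w\<in>V. real (d w) / Q * (exp (s * real (d w)) - 1)))"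
      by (simp add: sum_distrib_left algebra_simps diff_divide_distrib)
    also have "\<dots> \<le> c * (k * ?N F) * (\<rho> * exp (2 * s))"
      using c k \<rho>(2) by (intro mult_left_mono) auto
    also have "\<dots> = k * (?N F * exp (s * ?S) * \<rho> ^ (m - t))"
    proof -
      have "exp (s * (?S - 2)) * exp (2 * s) = exp (s * ?S)"
        by (simp add: algebra_simps flip: exp_add)
      then show ?thesis by (simp add: c_def l mult_ac)
    qed
    finally show ?thesis using k by simp
  qed
qed

text \<open>The start of the exploration: one vertex, no edges, and residual degree
  \<open>d v\<close>.\<close>

lemma card_large_component:
  fixes d :: "'a \<Rightarrow> nat" and s \<rho> Q :: real
  assumes "finite V" and "\<And>i. i \<in> V \<Longrightarrow> d i \<le> \<Delta>"
    and "0 < Q" "Q \<le> real (\<Sum>i\<in>V. d i) - 2 * real m - 2 * (real \<Delta> * (real \<Delta> + 1))"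
    and "0 \<le> s" "0 < \<rho>"
      "1 + (\<Sum>w\<in>V. real (d w) / Q * (exp (s * real (d w)) - 1)) \<le> \<rho> * exp (2 * s)"
    and "v \<in> V"
  shows "real (card {E \<in> realizations V d {}. m < card (E\<^sup>* `` {v})})
    \<le> real (card (realizations V d {})) * exp (s * real (d v)) * \<rho> ^ m"
  using card_large_component_aux[OF assms(1-7), of 0 v "{v}" "{}"] assms(8)
  by (simp add: sym_def)

section \<open>Transfer to the random graph\<close>

lemma bij_betw_parcs_realizations:
  "bij_betw parcs (graphs_with_degrees n d) (realizations {1..n} d {})"
proof (rule bij_betw_byWitness[where f' = "\<lambda>E. \<lparr>pverts = {1..n}, parcs = E\<rparr>"])
  have out: "out_degree (with_proj G) i = card (parcs G `` {i})" for G :: "nat pair_pre_digraph" and i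
  proof -
    have "out_arcs (with_proj G) i = Pair i ` (parcs G `` {i})"
      by (auto simp: out_arcs_def)
    then show ?thesis by (simp add: out_degree_def card_image inj_on_def)
  qed
  show "\<forall>G\<in>graphs_with_degrees n d. \<lparr>pverts = {1..n}, parcs = parcs G\<rparr> = G"
    by (auto simp: graphs_with_degrees_def)
  show "parcs ` graphs_with_degrees n d \<subseteq> realizations {1..n} d {}"
  proof
    fix E assume "E \<in> parcs ` graphs_with_degrees n d"
    then obtain G where G: "E = parcs G" "pair_graph G" "pverts G = {1..n}"
      "\<forall>i\<in>{1..n}. out_degree (with_proj G) i = d i"
      by (auto simp: graphs_with_degrees_def)
    interpret pair_graph G by (rule G(2))
    have "E \<subseteq> {1..n} \<times> {1..n}"
      using in_arcsD1 in_arcsD2 G(1,3) by auto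
    moreover have "irrefl E" using no_loops G(1) by (fastforce simp: irrefl_def)
    moreover have "sym E" using sym_arcs G(1) by (simp add: symmetric_def)
    ultimately show "E \<in> realizations {1..n} d {}"
      using G(1,4) out by (simp add: realizations_def)
  qed
  show "(\<lambda>E. \<lparr>pverts = {1..n}, parcs = E\<rparr>) ` realizations {1..n} d {} \<subseteq> graphs_with_degrees n d"
  proof safe
    fix E assume "E \<in> realizations {1..n} d {}"
    note E = realizationsD[OF this]
    have "pair_graph \<lparr>pverts = {1..n}, parcs = E\<rparr>"
    proof
      show "finite (parcs \<lparr>pverts = {1..n}, parcs = E\<rparr>)"
        using E(1) finite_subset[of E "{1..n} \<times> {1..n}"] by auto
      show "symmetric (with_proj \<lparr>pverts = {1..n}, parcs = E\<rparr>)"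
        using E(2) by (simp add: symmetric_def)
    qed (use E(1,3) in \<open>auto simp: irrefl_def\<close>)
    then show "\<lparr>pverts = {1..n}, parcs = E\<rparr> \<in> graphs_with_degrees n d"
      using E(4) out[of "\<lparr>pverts = {1..n}, parcs = E\<rparr>"] by (simp add: graphs_with_degrees_def)
  qed
qed auto

text \<open>A strongly connected component lies inside the set reachable from any of its
  vertices.\<close>

lemma large_component_realization:
  assumes "G \<in> graphs_with_degrees n d" "largest_component G C" "m < card C"
  shows "\<exists>v\<in>{1..n}. m < card ((parcs G)\<^sup>* `` {v})"
proof -
  interpret pair_graph G using assms(1) by (simp add: graphs_with_degrees_def)
  have V: "pverts G = {1..n}" using assms(1) by (simp add: graphs_with_degrees_def)
  have C: "C \<in> sccs_verts"
    using assms(2) by (simp add: largest_component_def is_arg_max_def)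
  have "C \<noteq> {}" using assms(3) by auto
  then obtain v where v: "v \<in> C" by auto
  have reach: "v \<rightarrow>\<^sup>*\<^bsub>with_proj G\<^esub> u" if "u \<in> C" for u
    using C v that by (simp add: in_sccs_verts_conv_reachable)
  have "C \<subseteq> (parcs G)\<^sup>* `` {v} \<inter> {1..n}"
  proof
    fix u assume "u \<in> C"
    then have u: "v \<rightarrow>\<^sup>*\<^bsub>with_proj G\<^esub> u" by (rule reach)
    then have "(v, u) \<in> (parcs G)\<^sup>*"
      using reachable_rtranclI[OF u] by simp
    moreover have "u \<in> {1..n}" using reachable_in_verts(2)[OF u] V by simp
    ultimately show "u \<in> (parcs G)\<^sup>* `` {v} \<inter> {1..n}" by simp
  qed
  moreover have "v \<in> {1..n}" using calculation v by auto
  moreover have "(parcs G)\<^sup>* `` {v} \<subseteq> insert v {1..n}"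
  proof -
    have "(v, u) \<in> (parcs G)\<^sup>* \<Longrightarrow> u \<in> insert v {1..n}" for u
      by (induction rule: rtrancl_induct) (use in_arcsD2 V in auto)
    then show ?thesis by (auto simp del: insert_iff)
  qed
  then have "finite ((parcs G)\<^sup>* `` {v})" by (rule finite_subset) simp
  ultimately have "card C \<le> card ((parcs G)\<^sup>* `` {v})" by (meson card_mono le_inf_iff)
  then show ?thesis using assms(3) \<open>v \<in> {1..n}\<close> by (auto intro!: bexI[of _ v])
qed

text \<open>Union bound over the starting vertex, with \<open>q\<close> bounding the probability for
  a single vertex. The event speaks of all largest components at once.\<close>

lemma prob_largest_component:
  fixes d :: "nat \<Rightarrow> nat"
  assumes "graphs_with_degrees n d \<noteq> {}"
    and bound: "\<And>v. v \<in> {1..n} \<Longrightarrow>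
      real (card {E \<in> realizations {1..n} d {}. m < card (E\<^sup>* `` {v})})
        \<le> real (card (realizations {1..n} d {})) * q"
  shows "1 - real n * q
    \<le> measure_pmf.prob (random_graph n d) {G. \<forall>C. largest_component G C \<longrightarrow> card C \<le> m}"
proof -
  let ?S = "graphs_with_degrees n d" and ?R = "realizations {1..n} d {}"
  let ?A = "{G. \<forall>C. largest_component G C \<longrightarrow> card C \<le> m}"
  let ?U = "\<Union>v\<in>{1..n}. {E \<in> ?R. m < card (E\<^sup>* `` {v})}"
  have bij: "inj_on parcs ?S" "parcs ` ?S = ?R"
    using bij_betw_parcs_realizations by (auto simp: bij_betw_def)
  have finS: "finite ?S" by (rule finite_graphs_with_degrees)
  have cardR: "card ?R = card ?S"
    using bij_betw_same_card[OF bij_betw_parcs_realizations] by simp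
  have pos: "0 < card ?S" using assms(1) finS by (simp add: card_gt_0_iff)
  have "parcs ` (?S - ?A) \<subseteq> ?U"
  proof
    fix E assume "E \<in> parcs ` (?S - ?A)"
    then obtain G where G: "E = parcs G" "G \<in> ?S" "G \<notin> ?A" by (elim imageE DiffE)
    from G(3) obtain C where C: "largest_component G C" "m < card C"
      unfolding mem_Collect_eq not_all not_imp not_le by blast
    then show "E \<in> ?U" using large_component_realization[OF G(2) C] G(1,2) bij(2) by auto
  qed
  moreover have "finite ?R" by (simp add: finite_realizations)
  ultimately have "card (parcs ` (?S - ?A)) \<le> card ?U"
    by (intro card_mono) auto
  then have "card (?S - ?A) \<le> card ?U"
    using card_image[OF inj_on_diff[OF bij(1)]] by simp
  also have "\<dots> \<le> (\<Sum>v\<in>{1..n}. card {E \<in> ?R. m < card (E\<^sup>* `` {v})})"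
    by (rule card_UN_le) simp
  finally have "real (card (?S - ?A)) \<le> (\<Sum>v\<in>{1..n}. real (card {E \<in> ?R. m < card (E\<^sup>* `` {v})}))"
    by (simp flip: of_nat_sum)
  also have "\<dots> \<le> (\<Sum>v\<in>{1..n}. real (card ?S) * q)"
    using bound cardR by (intro sum_mono) auto
  also have "\<dots> = real (card ?S) * (real n * q)" by simp
  finally have "real (card (?S - ?A)) \<le> real (card ?S) * (real n * q)" .
  moreover have "card (?S - ?A) = card ?S - card (?S \<inter> ?A)" "card (?S \<inter> ?A) \<le> card ?S"
    using finS by (auto intro: card_Diff_subset_Int card_mono[OF _ Int_lower1])
  then have "real (card (?S - ?A)) = real (card ?S) - real (card (?S \<inter> ?A))" by linarith
  ultimately have "real (card ?S) * (1 - real n * q) \<le> real (card (?S \<inter> ?A))"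
    by (simp add: algebra_simps)
  then show ?thesis
    using pos finS assms(1) by (simp add: random_graph_def measure_pmf_of_set field_simps)
qed

section \<open>Exponential and power moments of the degrees\<close>

text \<open>For \<open>x \<le> 1\<close> the quadratic remainder is at most
  \<open>x powr (1 + \<epsilon>)\<close>; for larger \<open>x\<close> the last term alone dominates.
  The exponent below 2 avoids third moments of the degrees, which the tail bound need not
  control.\<close>

lemma exp_le_one_plus_powr:
  fixes x \<epsilon> :: real
  assumes "0 \<le> x" "0 < \<epsilon>" "\<epsilon> \<le> 1"
  shows "exp x - 1 \<le> x + x powr (1 + \<epsilon>) * exp x"
proof (cases "x \<le> 1")
  case True
  have "exp x \<le> 1 + x + x\<^sup>2" using exp_bound assms True by blast
  moreover have "x\<^sup>2 \<le> x powr (1 + \<epsilon>)"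
    using assms True powr_mono'[of "1 + \<epsilon>" 2 x] by (cases "x = 0") simp_all
  moreover have "x powr (1 + \<epsilon>) * 1 \<le> x powr (1 + \<epsilon>) * exp x"
    using assms by (intro mult_left_mono) auto
  ultimately show ?thesis by simp
next
  case False
  then have "1 * exp x \<le> x powr (1 + \<epsilon>) * exp x"
    using assms by (intro mult_right_mono ge_one_powr_ge_zero) auto
  then have "exp x \<le> x powr (1 + \<epsilon>) * exp x" by simp
  then show ?thesis using assms(1) by linarith
qed

text \<open>The mean value theorem bounds each increment; this prepares a summation over the levels
  of the degrees.\<close>

lemma powr_le_sum_powr:
  fixes p :: real
  assumes "1 \<le> p"
  shows "real k powr p \<le> p * (\<Sum>j=1..k. real j powr (p - 1))"
proof (induction k)
  case (Suc k)
  have "real (Suc k) powr p \<le> real k powr p + p * real (Suc k) powr (p - 1)"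
  proof (cases "k = 0")
    case False
    have "\<exists>z>real k. z < real (Suc k) \<and>
        real (Suc k) powr p - real k powr p = (real (Suc k) - real k) * (p * z powr (p - 1))"
      using False by (intro MVT2) (auto intro!: derivative_eq_intros)
    then obtain z where z: "z > real k" "z < real (Suc k)"
      "real (Suc k) powr p - real k powr p = p * z powr (p - 1)" by auto
    have "p * z powr (p - 1) \<le> p * real (Suc k) powr (p - 1)"
      using z assms by (intro mult_left_mono powr_mono2) auto
    then show ?thesis using z(3) by simp
  qed (use assms in simp)
  then show ?case using Suc by (simp add: algebra_simps)
qed simp

lemma prob_degree_ge:
  assumes "n \<ge> 1"
  shows "measure_pmf.prob (degree_pmf n d) {k..} = real (card {i\<in>{1..n}. k \<le> d i}) / real n"
  using assms by (simp add: degree_pmf_def measure_pmf_of_set vimage_def Int_def conj_commute)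

text \<open>A single vertex of degree \<open>k\<close> already forces the tail at \<open>k\<close>
  to be at least \<open>1 / n\<close>.\<close>

lemma degree_le_of_tail:
  fixes \<gamma> C :: real
  assumes "n \<ge> 1" "\<gamma> > 1" "C > 0"
    and tail: "\<And>k. k \<ge> 1 \<Longrightarrow> measure_pmf.prob (degree_pmf n d) {k..} \<le> C * real k powr (1 - \<gamma>)"
    and "i \<in> {1..n}"
  shows "real (d i) \<le> C powr (1 / (\<gamma> - 1)) * real n powr (1 / (\<gamma> - 1))"
proof (cases "d i = 0")
  case False
  have "card {i} \<le> card {j\<in>{1..n}. d i \<le> d j}"
    using assms(5) by (intro card_mono) auto
  then have "1 / real n \<le> measure_pmf.prob (degree_pmf n d) {d i..}"
    using assms(1) by (simp add: prob_degree_ge divide_right_mono)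
  also have "\<dots> \<le> C * real (d i) powr (1 - \<gamma>)" using False tail by simp
  also have "\<dots> = C / real (d i) powr (\<gamma> - 1)"
    using powr_minus_divide[of "real (d i)" "\<gamma> - 1"] by simp
  finally have "real (d i) powr (\<gamma> - 1) \<le> C * real n"
    using False assms(1) by (simp add: field_simps)
  then have "(real (d i) powr (\<gamma> - 1)) powr (1 / (\<gamma> - 1)) \<le> (C * real n) powr (1 / (\<gamma> - 1))"
    using assms(2) by (intro powr_mono2) auto
  then show ?thesis using assms(2,3) by (simp add: powr_powr powr_mult)
qed (use assms in simp)

text \<open>Summation over levels: the power is written as a sum over \<open>j \<le> d i\<close>,
  the sums are exchanged, and the tail bound is applied at each \<open>j\<close>. The series
  converges because \<open>p - \<gamma> < - 1\<close>; its term at 0 is 0.\<close>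

lemma degree_moment_le_of_tail:
  fixes \<gamma> C p :: real
  assumes "n \<ge> 1" "1 \<le> p" "p < \<gamma> - 1"
    and tail: "\<And>k. k \<ge> 1 \<Longrightarrow> measure_pmf.prob (degree_pmf n d) {k..} \<le> C * real k powr (1 - \<gamma>)"
  shows "(\<Sum>i=1..n. real (d i) powr p) \<le> C * p * (\<Sum>k. real k powr (p - \<gamma>)) * real n"
proof -
  \<comment> \<open>A finite cut-off for exchanging the sums; it disappears when the series takes
    over.\<close>
  define K where "K = Max (d ` {1..n})"
  have K: "d i \<le> K" if "i \<in> {1..n}" for i using that by (simp add: K_def)
  have summ: "summable (\<lambda>k. real k powr (p - \<gamma>))" using assms by (simp add: summable_real_powr_iff)
  have C: "C \<ge> 0" using order_trans[OF measure_nonneg tail[of 1]] by simp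
  have "(\<Sum>i=1..n. real (d i) powr p) \<le> (\<Sum>i=1..n. p * (\<Sum>j=1..d i. real j powr (p - 1)))"
    by (intro sum_mono powr_le_sum_powr assms)
  also have "\<dots> = (\<Sum>i=1..n. \<Sum>j=1..K. if j \<le> d i then p * real j powr (p - 1) else 0)"
  proof (intro sum.cong refl)
    fix i assume "i \<in> {1..n}"
    then have "{1..d i} = {j\<in>{1..K}. j \<le> d i}" using K by fastforce
    then show "p * (\<Sum>j=1..d i. real j powr (p - 1))
        = (\<Sum>j=1..K. if j \<le> d i then p * real j powr (p - 1) else 0)"
      unfolding sum_distrib_left by (simp only: sum.inter_filter finite_atLeastAtMost)
  qed
  also have "\<dots> = (\<Sum>j=1..K. \<Sum>i=1..n. if j \<le> d i then p * real j powr (p - 1) else 0)"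
    by (rule sum.swap)
  also have "\<dots> = (\<Sum>j=1..K. real (card {i\<in>{1..n}. j \<le> d i}) * (p * real j powr (p - 1)))"
    by (simp flip: sum.inter_filter)
  also have "\<dots> \<le> (\<Sum>j=1..K. C * p * real n * real j powr (p - \<gamma>))"
  proof (intro sum_mono)
    fix j assume "j \<in> {1..K}"
    then have "real (card {i\<in>{1..n}. j \<le> d i}) \<le> real n * (C * real j powr (1 - \<gamma>))"
      using tail[of j] assms(1) by (simp add: prob_degree_ge field_simps)
    then have "real (card {i\<in>{1..n}. j \<le> d i}) * (p * real j powr (p - 1))
        \<le> real n * (C * real j powr (1 - \<gamma>)) * (p * real j powr (p - 1))"
      using assms by (intro mult_right_mono) auto
    also have "\<dots> = C * p * real n * (real j powr (1 - \<gamma>) * real j powr (p - 1))" by simp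
    also have "real j powr (1 - \<gamma>) * real j powr (p - 1) = real j powr (p - \<gamma>)"
      by (simp flip: powr_add)
    finally show "real (card {i\<in>{1..n}. j \<le> d i}) * (p * real j powr (p - 1))
        \<le> C * p * real n * real j powr (p - \<gamma>)" .
  qed
  also have "\<dots> = C * p * real n * (\<Sum>j=1..K. real j powr (p - \<gamma>))" by (simp add: sum_distrib_left)
  also have "\<dots> \<le> C * p * real n * (\<Sum>k. real k powr (p - \<gamma>))"
    using C assms by (intro mult_left_mono sum_le_suminf summ) auto
  finally show ?thesis by (simp add: mult_ac)
qed

lemma sum_exp_degree_le:
  fixes d :: "'a \<Rightarrow> nat" and s \<epsilon> M :: real
  assumes "0 \<le> s" "0 < \<epsilon>" "\<epsilon> \<le> 1" and M: "\<And>i. i \<in> V \<Longrightarrow> real (d i) \<le> M"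
  shows "(\<Sum>i\<in>V. real (d i) * (exp (s * real (d i)) - 1))
    \<le> s * ((\<Sum>i\<in>V. (real (d i))\<^sup>2) + s powr \<epsilon> * exp (s * M) * (\<Sum>i\<in>V. real (d i) powr (2 + \<epsilon>)))"
proof -
  have "real (d i) * (exp (s * real (d i)) - 1)
      \<le> s * (real (d i))\<^sup>2 + s * (s powr \<epsilon> * exp (s * M)) * real (d i) powr (2 + \<epsilon>)"
    if "i \<in> V" for i
  proof -
    let ?x = "real (d i)"
    have "exp (s * ?x) - 1 \<le> s * ?x + (s * ?x) powr (1 + \<epsilon>) * exp (s * ?x)"
      using assms by (intro exp_le_one_plus_powr) auto
    also have "\<dots> \<le> s * ?x + (s * ?x) powr (1 + \<epsilon>) * exp (s * M)"
      using M[OF that] assms(1) by (intro add_left_mono mult_left_mono) (auto intro: mult_left_mono)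
    finally have "?x * (exp (s * ?x) - 1)
        \<le> ?x * (s * ?x + (s * ?x) powr (1 + \<epsilon>) * exp (s * M))"
      by (intro mult_left_mono) auto
    also have "(s * ?x) powr (1 + \<epsilon>) = s * s powr \<epsilon> * ?x powr (1 + \<epsilon>)"
      using assms(1) by (simp add: powr_mult powr_add)
    also have "?x * (s * ?x + s * s powr \<epsilon> * ?x powr (1 + \<epsilon>) * exp (s * M))
        = s * ?x\<^sup>2 + s * (s powr \<epsilon> * exp (s * M)) * (?x * ?x powr (1 + \<epsilon>))"
      by (simp add: algebra_simps power2_eq_square)
    also have "?x * ?x powr (1 + \<epsilon>) = ?x powr (2 + \<epsilon>)"
      using powr_add[of ?x 1 "1 + \<epsilon>"] by simp
    finally show ?thesis .
  qed
  then have "(\<Sum>i\<in>V. real (d i) * (exp (s * real (d i)) - 1)) \<le>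
      (\<Sum>i\<in>V. s * (real (d i))\<^sup>2 + s * (s powr \<epsilon> * exp (s * M)) * real (d i) powr (2 + \<epsilon>))"
    by (rule sum_mono)
  also have "\<dots> = s * ((\<Sum>i\<in>V. (real (d i))\<^sup>2)
      + s powr \<epsilon> * exp (s * M) * (\<Sum>i\<in>V. real (d i) powr (2 + \<epsilon>)))"
    by (simp add: sum.distrib sum_distrib_left algebra_simps)
  finally show ?thesis .
qed

lemma sum_degrees_eq:
  assumes "n \<ge> 1"
  shows "(\<Sum>i=1..n. real (d i)) = real n * mean_degree n d"
  using assms by (simp add: mean_degree_eq)

text \<open>Through this identity \<open>nu_param\<close> enters: divided by the number of
  half-edges, the sum of squares is \<open>1 + \<nu>\<close>, the main term of the drift
  condition.\<close>

lemma sum_squares_degrees_eq: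
  assumes "n \<ge> 1" "mean_degree n d > 0"
  shows "(\<Sum>i=1..n. (real (d i))\<^sup>2) = real n * (mean_degree n d * (1 + nu_param n d))"
proof -
  have "(\<Sum>i=1..n. real (d i) * (real (d i) - 1)) = real n * mean_degree n d * nu_param n d"
    using assms by (simp add: nu_param_def)
  then show ?thesis
    using sum_degrees_eq[OF assms(1), of d]
    by (simp add: algebra_simps power2_eq_square sum_subtractf)
qed

section \<open>The estimate for fixed n\<close>

text \<open>The exploration bound with \<open>\<rho> = exp (- \<delta> * s)\<close>. A step consumes
  two half-edges and the hypothesis \<open>drift\<close> bounds what it gains by
  \<open>2 - \<delta>\<close>, so each step costs a factor \<open>\<rho>\<close>.\<close>

lemma prob_largest_component_ge:
  fixes d :: "nat \<Rightarrow> nat" and s \<delta> \<epsilon> M X Q K :: real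
  assumes ne: "graphs_with_degrees n d \<noteq> {}" and n: "n \<ge> 1"
    and \<epsilon>: "0 < \<epsilon>" "\<epsilon> \<le> 1" and s: "0 \<le> s" and "0 \<le> \<delta>" "0 \<le> X" "0 \<le> M"
    and M: "\<And>i. i \<in> {1..n} \<Longrightarrow> real (d i) \<le> M"
    and K: "(\<Sum>i=1..n. real (d i) powr (2 + \<epsilon>)) \<le> K"
    and Q: "Q = (\<Sum>i=1..n. real (d i)) - 2 * X - 2 * (M * (M + 1))" "Q > 0"
    and drift: "(\<Sum>i=1..n. (real (d i))\<^sup>2) / Q + s powr \<epsilon> * exp (s * M) * K / Q \<le> 2 - \<delta>"
  shows "1 - real n * (exp (s * M) * exp (\<delta> * s - \<delta> * s * X))
    \<le> measure_pmf.prob (random_graph n d) {G. \<forall>C. largest_component G C \<longrightarrow> real (card C) \<le> X}"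
proof -
  \<comment> \<open>The exploration needs integers. Rounding \<open>X\<close> down loses less than
    one step, which is the extra factor \<open>exp (\<delta> * s)\<close> in the conclusion.\<close>
  define m where "m = nat \<lfloor>X\<rfloor>"
  define \<Delta> where "\<Delta> = nat \<lfloor>M\<rfloor>"
  have m: "real m \<le> X" "X - 1 \<le> real m" using \<open>0 \<le> X\<close> by (auto simp: m_def)
  have \<Delta>: "real \<Delta> \<le> M" using \<open>0 \<le> M\<close> by (simp add: \<Delta>_def)
  have d\<Delta>: "d i \<le> \<Delta>" if "i \<in> {1..n}" for i using M[OF that] by (simp add: \<Delta>_def le_nat_floor)
  have "(\<Sum>i=1..n. real (d i) * (exp (s * real (d i)) - 1)) / Q
      \<le> s * ((\<Sum>i=1..n. (real (d i))\<^sup>2) + s powr \<epsilon> * exp (s * M) * (\<Sum>i=1..n. real (d i) powr (2 + \<epsilon>))) / Q"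
    using Q(2) by (intro divide_right_mono sum_exp_degree_le s \<epsilon> M) auto
  also have "\<dots> \<le> s * ((\<Sum>i=1..n. (real (d i))\<^sup>2) + s powr \<epsilon> * exp (s * M) * K) / Q"
    using Q(2) s K by (intro divide_right_mono mult_left_mono add_left_mono) auto
  also have "\<dots> = s * ((\<Sum>i=1..n. (real (d i))\<^sup>2) / Q + s powr \<epsilon> * exp (s * M) * K / Q)"
    by (simp add: add_divide_distrib distrib_left)
  also have "\<dots> \<le> s * (2 - \<delta>)" using drift s by (intro mult_left_mono)
  finally have "1 + (\<Sum>i=1..n. real (d i) * (exp (s * real (d i)) - 1)) / Q \<le> exp (s * (2 - \<delta>))"
    using exp_ge_add_one_self[of "s * (2 - \<delta>)"] by linarith
  also have "\<dots> = exp (- \<delta> * s) * exp (2 * s)" by (simp add: algebra_simps flip: exp_add)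
  finally have \<rho>: "1 + (\<Sum>i=1..n. real (d i) / Q * (exp (s * real (d i)) - 1)) \<le> exp (- \<delta> * s) * exp (2 * s)"
    by (simp add: sum_divide_distrib)
  have "real \<Delta> * (real \<Delta> + 1) \<le> M * (M + 1)"
    using \<Delta> \<open>0 \<le> M\<close> by (intro mult_mono) auto
  then have Q': "Q \<le> real (\<Sum>i=1..n. d i) - 2 * real m - 2 * (real \<Delta> * (real \<Delta> + 1))"
    using Q(1) m(1) by simp
  have "1 - real n * (exp (s * M) * exp (- \<delta> * s) ^ m)
    \<le> measure_pmf.prob (random_graph n d) {G. \<forall>C. largest_component G C \<longrightarrow> card C \<le> m}"
  proof (rule prob_largest_component[OF ne])
    fix v assume v: "v \<in> {1..n}"
    have "real (card {E \<in> realizations {1..n} d {}. m < card (E\<^sup>* `` {v})})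
        \<le> real (card (realizations {1..n} d {})) * exp (s * real (d v)) * exp (- \<delta> * s) ^ m"
      by (rule card_large_component[OF _ d\<Delta> Q(2) Q' s _ \<rho> v]) auto
    also have "\<dots> \<le> real (card (realizations {1..n} d {})) * exp (s * M) * exp (- \<delta> * s) ^ m"
      using M[OF v] s by (intro mult_right_mono mult_left_mono) (auto intro: mult_left_mono)
    finally show "real (card {E \<in> realizations {1..n} d {}. m < card (E\<^sup>* `` {v})})
        \<le> real (card (realizations {1..n} d {})) * (exp (s * M) * exp (- \<delta> * s) ^ m)"
      by (simp add: mult.assoc)
  qed
  moreover have "exp (- \<delta> * s) ^ m \<le> exp (\<delta> * s - \<delta> * s * X)"
  proof -
    have "(\<delta> * s) * (X - 1) \<le> (\<delta> * s) * real m"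
      using m(2) s \<open>0 \<le> \<delta>\<close> by (intro mult_left_mono) auto
    then show ?thesis by (simp add: algebra_simps flip: exp_of_nat_mult)
  qed
  then have "real n * (exp (s * M) * exp (- \<delta> * s) ^ m) \<le> real n * (exp (s * M) * exp (\<delta> * s - \<delta> * s * X))"
    by (intro mult_left_mono) auto
  moreover have "measure_pmf.prob (random_graph n d) {G. \<forall>C. largest_component G C \<longrightarrow> card C \<le> m}
      \<le> measure_pmf.prob (random_graph n d) {G. \<forall>C. largest_component G C \<longrightarrow> real (card C) \<le> X}"
    using m(1) by (intro measure_pmf.finite_measure_mono) (auto intro: order_trans[OF of_nat_mono])
  ultimately show ?thesis by linarith
qed

section \<open>Choice of constants and passage to the limit\<close>

theorem theorem1p1:
  fixes d :: "nat \<Rightarrow> nat \<Rightarrow> nat"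
    and mu_inf nu_inf \<gamma> :: real
  assumes graphical: "\<And>n. n \<ge> 1 \<Longrightarrow> graphs_with_degrees n (d n) \<noteq> {}"
    and mu_lim: "(\<lambda>n. mean_degree n (d n)) \<longlonglongrightarrow> mu_inf"
    and nu_lim: "(\<lambda>n. nu_param n (d n)) \<longlonglongrightarrow> nu_inf"
    and "mu_inf > 0"
    and "nu_inf < 1"
    and "\<gamma> > 3"
    and tail: "\<exists>C::real. \<forall>n\<ge>1. \<forall>k\<ge>1.
      measure_pmf.prob (degree_pmf n (d n)) {k..} \<le> C * real k powr (1 - \<gamma>)"
  shows "\<exists>A::real.
    (\<lambda>n. measure_pmf.prob (random_graph n (d n))
       {G. \<forall>C. largest_component G C \<longrightarrow> real (card C) \<le> A * real n powr (1 / (\<gamma> - 1))})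
    \<longlonglongrightarrow> 1"
proof -
  obtain C0 where C0: "\<And>n k. n \<ge> 1 \<Longrightarrow> k \<ge> 1 \<Longrightarrow>
      measure_pmf.prob (degree_pmf n (d n)) {k..} \<le> C0 * real k powr (1 - \<gamma>)"
    using tail by blast
  define C where "C = max C0 1"
  have C: "C > 0" by (simp add: C_def)
  have C_tail: "measure_pmf.prob (degree_pmf n (d n)) {k..} \<le> C * real k powr (1 - \<gamma>)"
    if "n \<ge> 1" "k \<ge> 1" for n k
  proof -
    have "C0 * real k powr (1 - \<gamma>) \<le> C * real k powr (1 - \<gamma>)"
      by (intro mult_right_mono) (auto simp: C_def)
    then show ?thesis using C0[OF that] by linarith
  qed
  \<comment> \<open>\<open>2 * a < 1\<close> is what \<open>\<gamma> > 3\<close> provides: the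
    square of the maximum degree is of smaller order than \<open>n\<close>.\<close>
  define a where "a = 1 / (\<gamma> - 1)"
  have a: "0 < a" "2 * a < 1" using \<open>\<gamma> > 3\<close> by (auto simp: a_def field_simps)
  define C1 where "C1 = C powr a"
  have C1: "C1 > 0" using C by (simp add: C1_def)
  \<comment> \<open>Small enough for moments of order \<open>2 + \<epsilon>\<close> to be controlled
    by the tail, and at most 1 for the exponential inequality.\<close>
  define \<epsilon> where "\<epsilon> = min 1 ((\<gamma> - 3) / 2)"
  have \<epsilon>: "0 < \<epsilon>" "\<epsilon> \<le> 1" "2 + \<epsilon> < \<gamma> - 1" using \<open>\<gamma> > 3\<close> by (auto simp: \<epsilon>_def min_def field_simps)
  define C2 where "C2 = C * (2 + \<epsilon>) * (\<Sum>k. real k powr (2 + \<epsilon> - \<gamma>))"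
  \<comment> \<open>Makes \<open>exp (s n * M)\<close> equal to
    \<open>n powr (a * \<epsilon> / 2)\<close> for the degree bound
    \<open>M = C1 * n powr a\<close>, while \<open>s n powr \<epsilon>\<close> decays like
    \<open>n powr (- a * \<epsilon>)\<close> up to a logarithmic factor.\<close>
  define b where "b = a * \<epsilon> / (2 * C1)"
  have b: "b > 0" "b * C1 = a * \<epsilon> / 2" using a \<epsilon> C1 by (auto simp: b_def)
  \<comment> \<open>Half of the gap between \<open>1 + nu_inf\<close> and 2; the other half absorbs
    the errors at finite \<open>n\<close>.\<close>
  define \<delta> where "\<delta> = (1 - nu_inf) / 2"
  have \<delta>: "\<delta> > 0" "1 + nu_inf < 2 - \<delta>" using \<open>nu_inf < 1\<close> by (auto simp: \<delta>_def field_simps)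
  \<comment> \<open>Chosen so that the exploration contributes \<open>n powr - (2 + b * C1)\<close>.
    This beats the factor \<open>n\<close> of the union bound and the factor
    \<open>n powr (b * C1)\<close> of the starting vertex, leaving \<open>1 / n\<close>.\<close>
  define A where "A = (2 + b * C1) / (\<delta> * b)"
  have A: "A \<ge> 0" "\<delta> * (b * A) = 2 + b * C1" using b \<delta> C1 by (auto simp: A_def)
  define s where "s n = b * (ln (real n) / real n powr a)" for n :: nat
  define Q where "Q n = (\<Sum>i=1..n. real (d n i)) - 2 * (A * real n powr a)
      - 2 * ((C1 * real n powr a) * (C1 * real n powr a + 1))" for n
  let ?mu = "\<lambda>n. mean_degree n (d n)" and ?nu = "\<lambda>n. nu_param n (d n)"
  let ?P = "\<lambda>n. measure_pmf.prob (random_graph n (d n))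
      {G. \<forall>C. largest_component G C \<longrightarrow> real (card C) \<le> A * real n powr (1 / (\<gamma> - 1))}"

  have s_nonneg: "s n \<ge> 0" if "n \<ge> 1" for n
    using that b by (simp add: s_def)
  have s_M: "exp (s n * (C1 * real n powr a)) = real n powr (b * C1)" if "n \<ge> 1" for n
    using that by (simp add: s_def powr_def mult_ac)
  have s_lim: "s \<longlonglongrightarrow> 0"
    unfolding s_def using tendsto_mult_right_zero[OF lim_ln_over_power[OF a(1)]] by blast

  have powr_lim: "(\<lambda>n. real n powr c) \<longlonglongrightarrow> 0" if "c < 0" for c
    using that by (intro tendsto_neg_powr filterlim_real_sequentially)
  \<comment> \<open>After division by \<open>n\<close> the corrections in \<open>Q n\<close> have
    negative exponents \<open>a - 1\<close> and \<open>2 * a - 1\<close>.\<close>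
  have "(\<lambda>n. ?mu n - 2 * A * real n powr (a - 1) - 2 * C1\<^sup>2 * real n powr (2 * a - 1)
      - 2 * C1 * real n powr (a - 1)) \<longlonglongrightarrow> mu_inf - 2 * A * 0 - 2 * C1\<^sup>2 * 0 - 2 * C1 * 0"
    using a by (intro tendsto_intros mu_lim powr_lim) auto
  moreover have "\<forall>\<^sub>F n in sequentially. ?mu n - 2 * A * real n powr (a - 1)
      - 2 * C1\<^sup>2 * real n powr (2 * a - 1) - 2 * C1 * real n powr (a - 1) = Q n / real n"
    using eventually_ge_at_top[of 1]
  proof eventually_elim
    case (elim n)
    have *: "real n powr (a - 1) = real n powr a / real n"
      "real n powr (2 * a - 1) = real n powr a * real n powr a / real n"
      using elim by (simp_all add: powr_diff flip: powr_add)
    show ?case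
      unfolding Q_def sum_degrees_eq[OF elim] *
      using elim by (simp add: field_simps power2_eq_square)
  qed
  ultimately have Q_lim: "(\<lambda>n. Q n / real n) \<longlonglongrightarrow> mu_inf"
    by (force intro: Lim_transform_eventually)

  \<comment> \<open>The error term of the drift, rewritten as a single power whose base tends to 0:
    half of the decay of \<open>s n\<close> compensates the growth of the exponential.\<close>
  have "(\<lambda>n. (b * (ln (real n) / real n powr (a / 2))) powr \<epsilon>) \<longlonglongrightarrow> 0"
  proof (rule tendsto_zero_powrI)
    show "(\<lambda>n. b * (ln (real n) / real n powr (a / 2))) \<longlonglongrightarrow> 0"
      using a by (intro tendsto_mult_right_zero lim_ln_over_power) auto
    show "\<forall>\<^sub>F n in sequentially. 0 \<le> b * (ln (real n) / real n powr (a / 2))"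
      using eventually_ge_at_top[of 1] by eventually_elim (use b in auto)
  qed (use \<epsilon> in auto)
  moreover have "\<forall>\<^sub>F n in sequentially. (b * (ln (real n) / real n powr (a / 2))) powr \<epsilon>
      = s n powr \<epsilon> * real n powr (b * C1)"
    using eventually_ge_at_top[of 1]
  proof eventually_elim
    case (elim n)
    have "real n powr a = real n powr (a / 2) * real n powr (a / 2)"
      by (simp flip: powr_add)
    then have "b * (ln (real n) / real n powr (a / 2)) = s n * real n powr (a / 2)"
      using elim by (simp add: s_def)
    moreover have "(real n powr (a / 2)) powr \<epsilon> = real n powr (b * C1)"
      unfolding b(2) by (simp add: powr_powr)
    ultimately show ?case using s_nonneg[OF elim] by (simp add: powr_mult)
  qed
  ultimately have T_lim: "(\<lambda>n. s n powr \<epsilon> * real n powr (b * C1)) \<longlonglongrightarrow> 0"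
    by (rule Lim_transform_eventually)

  \<comment> \<open>The left side of the drift condition tends to \<open>1 + nu_inf\<close>, which
    is strictly below \<open>2 - \<delta>\<close>.\<close>
  have "(\<lambda>n. ?mu n * (1 + ?nu n) / (Q n / real n)
      + s n powr \<epsilon> * real n powr (b * C1) * C2 / (Q n / real n))
    \<longlonglongrightarrow> mu_inf * (1 + nu_inf) / mu_inf + 0 * C2 / mu_inf"
    using \<open>mu_inf > 0\<close> by (intro tendsto_intros mu_lim nu_lim Q_lim T_lim) auto
  then have "\<forall>\<^sub>F n in sequentially. ?mu n * (1 + ?nu n) / (Q n / real n)
      + s n powr \<epsilon> * real n powr (b * C1) * C2 / (Q n / real n) < 2 - \<delta>"
    using \<open>mu_inf > 0\<close> \<delta>(2) by (intro order_tendstoD(2)) auto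
  moreover have "\<forall>\<^sub>F n in sequentially. 0 < Q n / real n" "\<forall>\<^sub>F n in sequentially. 0 < ?mu n"
    using order_tendstoD(1)[OF Q_lim \<open>mu_inf > 0\<close>] order_tendstoD(1)[OF mu_lim \<open>mu_inf > 0\<close>] by auto
  ultimately have lower: "\<forall>\<^sub>F n in sequentially. 1 - real n powr (- 1) * exp (\<delta> * s n) \<le> ?P n"
    using eventually_ge_at_top[of 1]
  proof eventually_elim
    case (elim n)
    note n = elim(4)
    let ?M = "C1 * real n powr a" and ?X = "A * real n powr a"
    have "1 - real n * (exp (s n * ?M) * exp (\<delta> * s n - \<delta> * s n * ?X))
      \<le> measure_pmf.prob (random_graph n (d n)) {G. \<forall>C. largest_component G C \<longrightarrow> real (card C) \<le> ?X}"
    proof (rule prob_largest_component_ge[where \<epsilon> = \<epsilon> and Q = "Q n" and K = "C2 * real n"])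
      show "graphs_with_degrees n (d n) \<noteq> {}" by (rule graphical[OF n])
      show "real (d n i) \<le> ?M" if "i \<in> {1..n}" for i
        using degree_le_of_tail[OF n _ C C_tail[OF n] that] \<open>\<gamma> > 3\<close> by (simp add: C1_def a_def)
      show "(\<Sum>i=1..n. real (d n i) powr (2 + \<epsilon>)) \<le> C2 * real n"
        unfolding C2_def using \<epsilon> by (intro degree_moment_le_of_tail n C_tail) auto
      show "Q n > 0" using elim(2) n by (simp add: zero_less_divide_iff)
      then show "(\<Sum>i=1..n. (real (d n i))\<^sup>2) / Q n + s n powr \<epsilon> * exp (s n * ?M) * (C2 * real n) / Q n \<le> 2 - \<delta>"
        using elim(1) n sum_squares_degrees_eq[OF n elim(3)] s_M[OF n] by (simp add: field_simps)
    qed (use n \<epsilon> \<delta> A C1 s_nonneg in \<open>auto simp: Q_def\<close>)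
    also have "exp (\<delta> * s n - \<delta> * s n * ?X) = exp (\<delta> * s n) * real n powr - (2 + b * C1)"
    proof -
      have "\<delta> * s n * ?X = \<delta> * (b * A) * ln (real n)" using n by (simp add: s_def)
      then have "exp (\<delta> * s n - \<delta> * s n * ?X) = exp (\<delta> * s n) * exp (- (2 + b * C1) * ln (real n))"
        unfolding A(2) by (simp add: left_diff_distrib distrib_right flip: exp_add)
      then show ?thesis using n by (simp add: powr_def)
    qed
    also have "real n * (exp (s n * ?M) * (exp (\<delta> * s n) * real n powr - (2 + b * C1)))
        = (real n powr 1 * real n powr (b * C1) * real n powr - (2 + b * C1)) * exp (\<delta> * s n)"
      using n by (simp add: s_M)
    also have "real n powr 1 * real n powr (b * C1) * real n powr - (2 + b * C1) = real n powr (- 1)"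
      unfolding powr_add[symmetric] by simp
    finally show ?case by (simp add: a_def)
  qed
  have "(\<lambda>n. 1 - real n powr (- 1) * exp (\<delta> * s n)) \<longlonglongrightarrow> 1 - 0 * exp (\<delta> * 0)"
    by (intro tendsto_intros powr_lim s_lim) auto
  then have "?P \<longlonglongrightarrow> 1"
    by (intro tendsto_sandwich[OF lower _ _ tendsto_const]) auto
  then show ?thesis by blast
qed

end
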